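(* Let $(X,\delta_1)$ be a proximity space and let $\delta_2,\delta_2'$ be proximities on a set $Y$. Let $f_1,f_2:(X,\delta_1)\to(Y,\delta_2)$ and $g_1,g_2:(X,\delta_1)\to(Y,\delta_2')$ be pc-maps such that $f_1\simeq_{\delta_1,\delta_2}f_2$ and $g_1\simeq_{\delta_1,\delta_2'}g_2$. If $\delta_2'>\delta_2$, then $$\mathrm{D}_{\delta_1,\delta_2}(f_1,g_1)\le \mathrm{D}_{\delta_1,\delta_2'}(f_2,g_2).$$
   Context: A proximity on a set $X$ is a binary relation $\delta$ on subsets of $X$ such that for all $E,F,G\subset X$: $E\delta F\Rightarrow F\delta E$; $(E\cup F)\delta G\Leftrightarrow (E\delta G$ or $F\delta G)$; $E\delta F\Rightarrow E\ne\emptyset$ and $F\neq\emptyset$; $E\cap F\ne\emptyset\Rightarrow E\delta F$; if $E\delta F$ fails, there is $G\subset X$ such that $E\delta G$ fails and $(X\setminus G)\delta F$ fails. $E\delta F$ is read "$E$ is near $F$". $\delta'>\delta$ ($\delta'$ is finer than $\delta$) on the same set means that $E\delta'F$ implies $E\delta F$. Subsets carry the subspace proximity (restriction). A product $X\times X'$ carries the product proximity (Leader): $A$ is near $B$ iff for all finite covers $A=\bigcup_i A_i$, $B=\bigcup_j B_j$ there are $i,j$ such that both projections of $A_i$ are near the corresponding projections of $B_j$; for rectangles, $E_1\times E_2$ is near $F_1\times F_2$ iff $E_1$ is near $F_1$ and $E_2$ is near $F_2$. A map $f:(X,\delta)\to(X',\delta')$ is a pc-map if $E\delta F$ implies $f(E)\delta'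 f(F)$. $I=[0,1]$ carries its usual metric proximity. Maps $f,g:X\to Y$ are proximally homotopic with respect to proximities $\delta$ on $X$ and $\delta'$ on $Y$, written $f\simeq_{\delta,\delta'}g$, if there is a pc-map $G:X\times I\to Y$ with $G(x,0)=f(x)$ and $G(x,1)=g(x)$. The proximal homotopic distance $\mathrm{D}_{\delta,\delta'}(f,g)$ is the least integer $m>0$ such that $X$ has a cover $\{V_1,\dots,V_m\}$ by (arbitrary) subsets with $f|_{V_j}\simeq_{\delta,\delta'}g|_{V_j}$ for all $j$ (with the subspace proximity on $V_j$), and $\infty$ if there is no such cover. This definition is used with the same wording for maps $f,g:X\to Y$ that are not assumed to be pc-maps for the proximities in the subscript. *)

theory Defs
  imports "HOL-Analysis.Analysis" "HOL-Library.Extended_Nat" "HOL-Library.FuncSet"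
begin

text \<open>
  A proximity lives on a carrier set and relates only subsets of that carrier
  (\<open>near_subset\<close>), so it is literally a binary relation on the power set of the carrier.
\<close>

locale proximity_space =
  fixes X :: "'a set" and \<delta> :: "'a set \<Rightarrow> 'a set \<Rightarrow> bool"
  assumes near_subset: "\<delta> E F \<Longrightarrow> E \<subseteq> X \<and> F \<subseteq> X"
    and near_sym: "\<delta> E F \<Longrightarrow> \<delta> F E"
    and near_Un: "\<lbrakk>E \<subseteq> X; F \<subseteq> X; G \<subseteq> X\<rbrakk> \<Longrightarrow> \<delta> (E \<union> F) G \<longleftrightarrow> \<delta> E G \<or> \<delta> F G"
    and near_nonempty: "\<delta> E F \<Longrightarrow> E \<noteq> {} \<and> F \<noteq> {}"
    and near_Int: "\<lbrakk>E \<subseteq> X; F \<subseteq> X; E \<inter> F \<noteq> {}\<rbrakk> \<Longrightarrow> \<delta> E F"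
    and far_separate: "\<lbrakk>E \<subseteq> X; F \<subseteq> X; \<not> \<delta> E F\<rbrakk> \<Longrightarrow> \<exists>G\<subseteq>X. \<not> \<delta> E G \<and> \<not> \<delta> (X - G) F"

definition finer_proximity ::
  "('a set \<Rightarrow> 'a set \<Rightarrow> bool) \<Rightarrow> ('a set \<Rightarrow> 'a set \<Rightarrow> bool) \<Rightarrow> bool" where
  "finer_proximity \<delta>' \<delta> \<longleftrightarrow> (\<forall>E F. \<delta>' E F \<longrightarrow> \<delta> E F)"

definition sub_proximity ::
  "('a set \<Rightarrow> 'a set \<Rightarrow> bool) \<Rightarrow> 'a set \<Rightarrow> 'a set \<Rightarrow> 'a set \<Rightarrow> bool" where
  "sub_proximity \<delta> V E F \<longleftrightarrow> E \<subseteq> V \<and> F \<subseteq> V \<and> \<delta> E F"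

text \<open>Leader's product proximity; a finite cover is given as a finite set of sets.\<close>

definition prod_proximity ::
  "'a set \<Rightarrow> ('a set \<Rightarrow> 'a set \<Rightarrow> bool) \<Rightarrow> 'b set \<Rightarrow> ('b set \<Rightarrow> 'b set \<Rightarrow> bool) \<Rightarrow>
   ('a \<times> 'b) set \<Rightarrow> ('a \<times> 'b) set \<Rightarrow> bool" where
  "prod_proximity X \<delta> X' \<delta>' A B \<longleftrightarrow>
     A \<subseteq> X \<times> X' \<and> B \<subseteq> X \<times> X' \<and>
     (\<forall>\<A> \<B>. finite \<A> \<and> finite \<B> \<and> \<Union>\<A> = A \<and> \<Union>\<B> = B \<longrightarrow>
        (\<exists>P\<in>\<A>. \<exists>Q\<in>\<B>. \<delta> (fst ` P) (fst ` Q) \<and> \<delta>' (snd ` P) (snd ` Q)))"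

text \<open>
  The nonemptiness conditions are needed because \<open>setdist\<close> is \<open>0\<close> when one of
  the sets is empty.
\<close>

definition metric_proximity :: "'a::metric_space set \<Rightarrow> 'a set \<Rightarrow> 'a set \<Rightarrow> bool" where
  "metric_proximity X E F \<longleftrightarrow>
     E \<subseteq> X \<and> F \<subseteq> X \<and> E \<noteq> {} \<and> F \<noteq> {} \<and> setdist E F = 0"

definition pc_map ::
  "'a set \<Rightarrow> ('a set \<Rightarrow> 'a set \<Rightarrow> bool) \<Rightarrow> 'b set \<Rightarrow> ('b set \<Rightarrow> 'b set \<Rightarrow> bool) \<Rightarrow>
   ('a \<Rightarrow> 'b) \<Rightarrow> bool" where
  "pc_map X \<delta> Y \<delta>' f \<longleftrightarrow>
     f \<in> X \<rightarrow> Y \<and> (\<forall>E F. E \<subseteq> X \<and> F \<subseteq> X \<and> \<delta> E F \<longrightarrow> \<delta>' (f ` E) (f ` F))"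

definition prox_homotopic ::
  "'a set \<Rightarrow> ('a set \<Rightarrow> 'a set \<Rightarrow> bool) \<Rightarrow> 'b set \<Rightarrow> ('b set \<Rightarrow> 'b set \<Rightarrow> bool) \<Rightarrow>
   ('a \<Rightarrow> 'b) \<Rightarrow> ('a \<Rightarrow> 'b) \<Rightarrow> bool" where
  "prox_homotopic X \<delta> Y \<delta>' f g \<longleftrightarrow>
     (\<exists>G. pc_map (X \<times> {0..1::real})
            (prod_proximity X \<delta> {0..1} (metric_proximity {0..1})) Y \<delta>' G \<and>
          (\<forall>x\<in>X. G (x, 0) = f x \<and> G (x, 1) = g x))"

text \<open>
  The restriction of \<open>f\<close> to \<open>V\<close> is \<open>f\<close> itself considered on the carrier \<open>V\<close>.
  The maps \<open>f\<close> and \<open>g\<close> are not required to be pc-maps.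
\<close>

definition prox_homotopic_cover ::
  "'a set \<Rightarrow> ('a set \<Rightarrow> 'a set \<Rightarrow> bool) \<Rightarrow> 'b set \<Rightarrow> ('b set \<Rightarrow> 'b set \<Rightarrow> bool) \<Rightarrow>
   ('a \<Rightarrow> 'b) \<Rightarrow> ('a \<Rightarrow> 'b) \<Rightarrow> nat \<Rightarrow> bool" where
  "prox_homotopic_cover X \<delta> Y \<delta>' f g m \<longleftrightarrow>
     (\<exists>V :: nat \<Rightarrow> 'a set. (\<Union>j\<in>{1..m}. V j) = X \<and>
        (\<forall>j\<in>{1..m}. prox_homotopic (V j) (sub_proximity \<delta> (V j)) Y \<delta>' f g))"

definition prox_homotopic_distance ::
  "'a set \<Rightarrow> ('a set \<Rightarrow> 'a set \<Rightarrow> bool) \<Rightarrow> 'b set \<Rightarrow> ('b set \<Rightarrow> 'b set \<Rightarrow> bool) \<Rightarrow>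
   ('a \<Rightarrow> 'b) \<Rightarrow> ('a \<Rightarrow> 'b) \<Rightarrow> enat" where
  "prox_homotopic_distance X \<delta> Y \<delta>' f g =
     (if \<exists>m>0. prox_homotopic_cover X \<delta> Y \<delta>' f g m
      then enat (LEAST m. m > 0 \<and> prox_homotopic_cover X \<delta> Y \<delta>' f g m)
      else \<infinity>)"

end

theory Submission imports Defs begin

text \<open>
  On any subset \<open>V\<close> of \<open>X\<close>, proximal homotopy is a symmetric and transitive relation; it passes
  from \<open>X\<close> to \<open>V\<close> (\<open>prox_homotopic_restrict\<close>) and from a proximity on \<open>Y\<close> to a coarser one
  (\<open>prox_homotopic_coarsen\<close>). Hence, if \<open>f2\<close> and \<open>g2\<close> are homotopic on \<open>V\<close> for \<open>\<delta>2'\<close>, then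
  \<open>f1 \<simeq> f2 \<simeq> g2 \<simeq> g1\<close> on \<open>V\<close> for \<open>\<delta>2\<close>, so every cover that is admissible for the right-hand
  distance is admissible for the left-hand one.

  Only transitivity needs an argument, because the concatenation of two homotopies has to be shown
  proximally continuous for Leader's product proximity. Additivity of that proximity reduces the
  question to near sets \<open>A\<close> and \<open>B\<close> lying on opposite sides of the slice \<open>X \<times> {c}\<close> where
  the homotopies \<open>G\<close> and \<open>H\<close> agree. Two facts then interact. In the product, \<open>A\<close> is near
  \<open>W \<times> {c}\<close> or \<open>B\<close> is near \<open>(X - W) \<times> {c}\<close>, for every \<open>W \<subseteq> X\<close>
  (\<open>prod_proximity_near_slice\<close>). If \<open>G ` A\<close> and \<open>H ` B\<close> were far in \<open>Y\<close>, they would be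
  separated by a set \<open>C\<close>, and for \<open>W\<close> the part of the slice mapped into \<open>C\<close> both alternatives
  fail.
\<close>

section \<open>Basic properties of proximities and pc-maps\<close>

context proximity_space
begin

lemma near_mono:
  assumes "\<delta> E F" "E \<subseteq> E'" "F \<subseteq> F'" "E' \<subseteq> X" "F' \<subseteq> X"
  shows "\<delta> E' F'"
proof -
  have left: "\<delta> (P \<union> E) F" if "\<delta> E F" "P \<subseteq> X" for P E F
    using near_subset[OF that(1)] near_Un[of P E F] that by blast
  have "\<delta> E' F"
    using left[OF assms(1), of E'] assms by (simp add: Un_absorb2)
  then have "\<delta> F E'" by (rule near_sym)
  then have "\<delta> F' E'"
    using left[of F E' F'] assms by (simp add: Un_absorb2)
  then show ?thesis by (rule near_sym)
qed

lemma near_Union_right: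
  assumes "finite \<C>" "\<delta> E (\<Union>\<C>)" "\<Union>\<C> \<subseteq> X"
  shows "\<exists>C\<in>\<C>. \<delta> E C"
  using assms
proof (induction \<C>)
  case empty
  then show ?case using near_nonempty by force
next
  case (insert C \<C>)
  have sub: "E \<subseteq> X" "C \<subseteq> X" "\<Union>\<C> \<subseteq> X"
    using insert.prems near_subset by auto
  have "\<delta> (C \<union> \<Union>\<C>) E"
    using insert.prems near_sym by simp
  then have "\<delta> C E \<or> \<delta> (\<Union>\<C>) E"
    using near_Un sub by blast
  then show ?case
    using near_sym insert.IH sub by blast
qed

lemma proximity_space_sub_proximity:
  assumes "V \<subseteq> X"
  shows "proximity_space V (sub_proximity \<delta> V)"
proof
  show "sub_proximity \<delta> V E F \<Longrightarrow> E \<subseteq> V \<and> F \<subseteq> V" for E F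
    by (simp add: sub_proximity_def)
  show "sub_proximity \<delta> V E F \<Longrightarrow> sub_proximity \<delta> V F E" for E F
    by (simp add: sub_proximity_def near_sym)
  show "sub_proximity \<delta> V (E \<union> F) G \<longleftrightarrow> sub_proximity \<delta> V E G \<or> sub_proximity \<delta> V F G"
    if "E \<subseteq> V" "F \<subseteq> V" "G \<subseteq> V" for E F G
    using near_Un[of E F G] that assms by (auto simp: sub_proximity_def)
  show "sub_proximity \<delta> V E F \<Longrightarrow> E \<noteq> {} \<and> F \<noteq> {}" for E F
    using near_nonempty by (auto simp: sub_proximity_def)
  show "sub_proximity \<delta> V E F" if "E \<subseteq> V" "F \<subseteq> V" "E \<inter> F \<noteq> {}" for E F
    using near_Int[of E F] that assms by (auto simp: sub_proximity_def)
  show "\<exists>G\<subseteq>V. \<not> sub_proximity \<delta> V E G \<and> \<not> sub_proximity \<delta> V (V - G) F"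
    if EF: "E \<subseteq> V" "F \<subseteq> V" "\<not> sub_proximity \<delta> V E F" for E F
  proof -
    have "\<not> \<delta> E F" "E \<subseteq> X" "F \<subseteq> X"
      using EF assms by (auto simp: sub_proximity_def)
    then obtain G where G: "G \<subseteq> X" "\<not> \<delta> E G" "\<not> \<delta> (X - G) F"
      using far_separate by blast
    have "\<not> \<delta> E (G \<inter> V)"
      using near_mono[of E "G \<inter> V" E G] G \<open>E \<subseteq> X\<close> by blast
    moreover have "\<not> \<delta> (V - G \<inter> V) F"
      using near_mono[of "V - G \<inter> V" F "X - G" F] G \<open>F \<subseteq> X\<close> assms by blast
    ultimately show ?thesis
      by (intro exI[of _ "G \<inter> V"]) (simp add: sub_proximity_def)
  qed
qed

end

lemma pc_map_comp:
  assumes f: "pc_map X \<delta> Y \<delta>' f" and g: "pc_map Y \<delta>' Z \<delta>'' g"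
  shows "pc_map X \<delta> Z \<delta>'' (g \<circ> f)"
  unfolding pc_map_def
proof (intro conjI allI impI)
  show "g \<circ> f \<in> X \<rightarrow> Z"
    using assms by (auto simp: pc_map_def Pi_iff)
  fix E F assume "E \<subseteq> X \<and> F \<subseteq> X \<and> \<delta> E F"
  then have "\<delta>' (f ` E) (f ` F)" "f ` E \<subseteq> Y" "f ` F \<subseteq> Y"
    using f by (auto simp: pc_map_def Pi_iff)
  then show "\<delta>'' ((g \<circ> f) ` E) ((g \<circ> f) ` F)"
    using g by (simp only: pc_map_def image_comp[symmetric])
qed

lemma pc_map_inclusion:
  assumes "V \<subseteq> X"
  shows "pc_map V (sub_proximity \<delta> V) X \<delta> id"
  using assms by (auto simp: pc_map_def sub_proximity_def)

lemma pc_map_coarsen: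
  assumes "pc_map X \<delta> Y \<delta>2' f" "finer_proximity \<delta>2' \<delta>2"
  shows "pc_map X \<delta> Y \<delta>2 f"
  using assms by (auto simp: pc_map_def finer_proximity_def)

section \<open>The metric proximity\<close>

lemma metric_proximity_iff:
  "metric_proximity X E F \<longleftrightarrow>
     E \<subseteq> X \<and> F \<subseteq> X \<and> (\<forall>e>0. \<exists>x\<in>E. \<exists>y\<in>F. dist x y < e)"
proof -
  have "setdist E F = 0 \<longleftrightarrow> (\<forall>e>0. \<exists>x\<in>E. \<exists>y\<in>F. dist x y < e)"
    if ne: "E \<noteq> {}" "F \<noteq> {}"
  proof
    assume "setdist E F = 0"
    then have "\<exists>x\<in>E. \<exists>y\<in>F. dist x y < e" if "e > 0" for e
      using setdist_ltE[of E F e] ne that by metis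
    then show "\<forall>e>0. \<exists>x\<in>E. \<exists>y\<in>F. dist x y < e" by blast
  next
    assume *: "\<forall>e>0. \<exists>x\<in>E. \<exists>y\<in>F. dist x y < e"
    have "setdist E F \<le> 0 + e" if e: "e > 0" for e
    proof -
      obtain x y where "x \<in> E" "y \<in> F" "dist x y < e"
        using * e by blast
      then show ?thesis using setdist_le_dist[of x E y F] by linarith
    qed
    then have "setdist E F \<le> 0" by (rule field_le_epsilon)
    then show "setdist E F = 0" using setdist_pos_le[of E F] by linarith
  qed
  moreover have "E \<noteq> {} \<and> F \<noteq> {}" if "\<forall>e>0. \<exists>x\<in>E. \<exists>y\<in>F. dist x y < e"
    using that zero_less_one by blast
  ultimately show ?thesis unfolding metric_proximity_def by blast
qed

lemma metric_proximity_sym: "metric_proximity X E F \<Longrightarrow> metric_proximity X F E"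
  by (simp add: metric_proximity_def setdist_sym)

lemma metric_proximity_mono:
  assumes "metric_proximity X E F" "E \<subseteq> E'" "F \<subseteq> F'" "E' \<subseteq> X" "F' \<subseteq> X"
  shows "metric_proximity X E' F'"
  using assms unfolding metric_proximity_iff by (meson subsetD)

lemma pc_map_lipschitz:
  fixes v :: "'a::metric_space \<Rightarrow> 'b::metric_space"
  assumes v: "v \<in> X \<rightarrow> Y" and L: "L > 0"
    and lip: "\<And>x y. x \<in> X \<Longrightarrow> y \<in> X \<Longrightarrow> dist (v x) (v y) \<le> L * dist x y"
  shows "pc_map X (metric_proximity X) Y (metric_proximity Y) v"
  unfolding pc_map_def
proof (intro conjI allI impI)
  show "v \<in> X \<rightarrow> Y" by (rule v)
  fix E F assume "E \<subseteq> X \<and> F \<subseteq> X \<and> metric_proximity X E F"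
  then have sub: "E \<subseteq> X" "F \<subseteq> X" and near: "\<forall>e>0. \<exists>x\<in>E. \<exists>y\<in>F. dist x y < e"
    by (auto simp: metric_proximity_iff)
  have "\<exists>x\<in>v ` E. \<exists>y\<in>v ` F. dist x y < e" if "e > 0" for e
  proof -
    have "e / L > 0" using that L by simp
    then obtain x y where xy: "x \<in> E" "y \<in> F" "dist x y < e / L"
      using near by blast
    then have "L * dist x y < e" using L by (simp add: field_simps)
    then have "dist (v x) (v y) < e"
      using lip[of x y] xy sub by force
    then show ?thesis using xy by blast
  qed
  then show "metric_proximity Y (v ` E) (v ` F)"
    using v sub by (auto simp: metric_proximity_iff)
qed

lemma metric_proximity_separating_point:
  fixes c :: real
  assumes "metric_proximity X E F" "E \<subseteq> {..c}" "F \<subseteq> {c..}" "c \<in> X"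
  shows "metric_proximity X E {c}" "metric_proximity X {c} F"
proof -
  have near: "\<exists>x\<in>E. \<exists>y\<in>F. dist x y < e" if "e > 0" for e
    using assms(1) that by (simp add: metric_proximity_iff)
  have "(\<exists>x\<in>E. dist x c < e) \<and> (\<exists>y\<in>F. dist c y < e)" if e: "e > 0" for e
  proof -
    obtain x y where xy: "x \<in> E" "y \<in> F" "dist x y < e"
      using near[OF e] by blast
    then have "x \<le> c" "c \<le> y" using assms by auto
    then have "dist x c < e" "dist c y < e"
      using xy by (auto simp: dist_real_def)
    then show ?thesis using xy by blast
  qed
  then show "metric_proximity X E {c}" "metric_proximity X {c} F"
    using assms by (auto simp: metric_proximity_iff)
qed

section \<open>The product proximity\<close>

lemma prod_proximityI:
  assumes "A \<subseteq> X \<times> X'" "B \<subseteq> X \<times> X'"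
    and "\<And>\<A> \<B>. \<lbrakk>finite \<A>; finite \<B>; \<Union>\<A> = A; \<Union>\<B> = B\<rbrakk> \<Longrightarrow>
           \<exists>P\<in>\<A>. \<exists>Q\<in>\<B>. \<delta> (fst ` P) (fst ` Q) \<and> \<delta>' (snd ` P) (snd ` Q)"
  shows "prod_proximity X \<delta> X' \<delta>' A B"
  using assms unfolding prod_proximity_def by blast

lemma prod_proximityD:
  assumes "prod_proximity X \<delta> X' \<delta>' A B" "finite \<A>" "finite \<B>" "\<Union>\<A> = A" "\<Union>\<B> = B"
  shows "\<exists>P\<in>\<A>. \<exists>Q\<in>\<B>. \<delta> (fst ` P) (fst ` Q) \<and> \<delta>' (snd ` P) (snd ` Q)"
  using assms unfolding prod_proximity_def by blast

lemma not_prod_proximityE: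
  assumes "\<not> prod_proximity X \<delta> X' \<delta>' A B" "A \<subseteq> X \<times> X'" "B \<subseteq> X \<times> X'"
  obtains \<A> \<B> where "finite \<A>" "finite \<B>" "\<Union>\<A> = A" "\<Union>\<B> = B"
    "\<not> (\<exists>P\<in>\<A>. \<exists>Q\<in>\<B>. \<delta> (fst ` P) (fst ` Q) \<and> \<delta>' (snd ` P) (snd ` Q))"
proof -
  have "\<exists>\<A> \<B>. finite \<A> \<and> finite \<B> \<and> \<Union>\<A> = A \<and> \<Union>\<B> = B \<and>
      \<not> (\<exists>P\<in>\<A>. \<exists>Q\<in>\<B>. \<delta> (fst ` P) (fst ` Q) \<and> \<delta>' (snd ` P) (snd ` Q))"
    using assms unfolding prod_proximity_def by simp
  then show thesis using that by blast
qed

lemma prod_proximity_subset: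
  "prod_proximity X \<delta> X' \<delta>' A B \<Longrightarrow> A \<subseteq> X \<times> X' \<and> B \<subseteq> X \<times> X'"
  by (simp add: prod_proximity_def)

lemma prod_proximity_sym:
  assumes near: "prod_proximity X \<delta> X' \<delta>' A B"
    and sym: "\<And>E F. \<delta> E F \<Longrightarrow> \<delta> F E" "\<And>E F. \<delta>' E F \<Longrightarrow> \<delta>' F E"
  shows "prod_proximity X \<delta> X' \<delta>' B A"
proof (rule prod_proximityI)
  show "B \<subseteq> X \<times> X'" "A \<subseteq> X \<times> X'" using prod_proximity_subset[OF near] by auto
  fix \<B> \<A> assume "finite \<B>" "finite \<A>" "\<Union>\<B> = B" "\<Union>\<A> = A"
  then show "\<exists>P\<in>\<B>. \<exists>Q\<in>\<A>. \<delta> (fst ` P) (fst ` Q) \<and> \<delta>' (snd ` P) (snd ` Q)"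
    using prod_proximityD[OF near, of \<A> \<B>] sym by blast
qed

lemma prod_proximity_Un_left:
  assumes near: "prod_proximity X \<delta> X' \<delta>' (A1 \<union> A2) B"
    and mono: "\<And>E F F'. \<lbrakk>\<delta> E F; F \<subseteq> F'; F' \<subseteq> X\<rbrakk> \<Longrightarrow> \<delta> E F'"
      "\<And>E F F'. \<lbrakk>\<delta>' E F; F \<subseteq> F'; F' \<subseteq> X'\<rbrakk> \<Longrightarrow> \<delta>' E F'"
  shows "prod_proximity X \<delta> X' \<delta>' A1 B \<or> prod_proximity X \<delta> X' \<delta>' A2 B"
proof (rule ccontr)
  assume "\<not> ?thesis"
  then have far: "\<not> prod_proximity X \<delta> X' \<delta>' A1 B" "\<not> prod_proximity X \<delta> X' \<delta>' A2 B" by auto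
  have sub: "A1 \<subseteq> X \<times> X'" "A2 \<subseteq> X \<times> X'" "B \<subseteq> X \<times> X'"
    using prod_proximity_subset[OF near] by auto
  obtain \<A>1 \<B>1 where 1: "finite \<A>1" "finite \<B>1" "\<Union>\<A>1 = A1" "\<Union>\<B>1 = B"
    and far1: "\<not> (\<exists>P\<in>\<A>1. \<exists>Q\<in>\<B>1. \<delta> (fst ` P) (fst ` Q) \<and> \<delta>' (snd ` P) (snd ` Q))"
    by (rule not_prod_proximityE[OF far(1) sub(1) sub(3)])
  obtain \<A>2 \<B>2 where 2: "finite \<A>2" "finite \<B>2" "\<Union>\<A>2 = A2" "\<Union>\<B>2 = B"
    and far2: "\<not> (\<exists>P\<in>\<A>2. \<exists>Q\<in>\<B>2. \<delta> (fst ` P) (fst ` Q) \<and> \<delta>' (snd ` P) (snd ` Q))"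
    by (rule not_prod_proximityE[OF far(2) sub(2) sub(3)])
  \<comment> \<open>The common refinement of the two covers of \<open>B\<close> works against both covers on the left.\<close>
  define \<B> where "\<B> = (\<lambda>(P, Q). P \<inter> Q) ` (\<B>1 \<times> \<B>2)"
  have "\<Union>\<B> = \<Union>\<B>1 \<inter> \<Union>\<B>2"
    by (auto simp: \<B>_def)
  then have \<B>: "finite \<B>" "\<Union>\<B> = B"
    using 1 2 by (simp_all add: \<B>_def)
  have \<A>: "finite (\<A>1 \<union> \<A>2)" "\<Union>(\<A>1 \<union> \<A>2) = A1 \<union> A2" using 1 2 by auto
  from prod_proximityD[OF near \<A>(1) \<B>(1) \<A>(2) \<B>(2)] obtain P Q where P: "P \<in> \<A>1 \<union> \<A>2" and Q: "Q \<in> \<B>"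
    and PQ: "\<delta> (fst ` P) (fst ` Q)" "\<delta>' (snd ` P) (snd ` Q)"
    by blast
  from Q obtain Q1 Q2 where Q12: "Q1 \<in> \<B>1" "Q2 \<in> \<B>2" "Q = Q1 \<inter> Q2"
    by (auto simp: \<B>_def)
  have enlarge: "\<delta> (fst ` P) (fst ` R) \<and> \<delta>' (snd ` P) (snd ` R)" if "Q \<subseteq> R" "R \<subseteq> B" for R
  proof
    have "R \<subseteq> X \<times> X'" using that sub by blast
    then have "fst ` R \<subseteq> X" "snd ` R \<subseteq> X'" by auto
    then show "\<delta> (fst ` P) (fst ` R)" "\<delta>' (snd ` P) (snd ` R)"
      using mono(1)[OF PQ(1) image_mono[OF that(1)]] mono(2)[OF PQ(2) image_mono[OF that(1)]]
      by blast+
  qed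
  have "Q1 \<subseteq> B" "Q2 \<subseteq> B" using Q12 1 2 by auto
  then show False
    using P enlarge[of Q1] enlarge[of Q2] far1 far2 Q12 by blast
qed

lemma pc_map_map_prod:
  fixes u :: "'a \<Rightarrow> 'b" and v :: "'c \<Rightarrow> 'd"
  assumes u: "pc_map X \<delta> Y \<epsilon> u" and v: "pc_map X' \<delta>' Y' \<epsilon>' v"
  shows "pc_map (X \<times> X') (prod_proximity X \<delta> X' \<delta>') (Y \<times> Y') (prod_proximity Y \<epsilon> Y' \<epsilon>')
           (map_prod u v)"
  unfolding pc_map_def
proof (intro conjI allI impI)
  let ?h = "map_prod u v"
  show h: "?h \<in> X \<times> X' \<rightarrow> Y \<times> Y'"
    using u v by (auto simp: pc_map_def Pi_iff)
  fix A B assume "A \<subseteq> X \<times> X' \<and> B \<subseteq> X \<times> X' \<and> prod_proximity X \<delta> X' \<delta>' A B"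
  then have sub: "A \<subseteq> X \<times> X'" "B \<subseteq> X \<times> X'" and near: "prod_proximity X \<delta> X' \<delta>' A B" by auto
  show "prod_proximity Y \<epsilon> Y' \<epsilon>' (?h ` A) (?h ` B)"
  proof (rule prod_proximityI)
    show "?h ` A \<subseteq> Y \<times> Y'" using h sub(1) by (auto simp: Pi_iff)
    show "?h ` B \<subseteq> Y \<times> Y'" using h sub(2) by (auto simp: Pi_iff)
    fix \<A> \<B> assume fin: "finite \<A>" "finite \<B>" and un: "\<Union>\<A> = ?h ` A" "\<Union>\<B> = ?h ` B"
    let ?\<A> = "(\<lambda>P. A \<inter> ?h -` P) ` \<A>" and ?\<B> = "(\<lambda>Q. B \<inter> ?h -` Q) ` \<B>"
    have "\<Union>?\<A> = A \<inter> ?h -` \<Union>\<A>" "\<Union>?\<B> = B \<inter> ?h -` \<Union>\<B>" by auto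
    moreover have "S \<inter> ?h -` ?h ` S = S" for S by blast
    ultimately have cover: "\<Union>?\<A> = A" "\<Union>?\<B> = B" by (simp_all only: un)
    from prod_proximityD[OF near _ _ cover] fin obtain P Q where PQ: "P \<in> \<A>" "Q \<in> \<B>"
      and near': "\<delta> (fst ` (A \<inter> ?h -` P)) (fst ` (B \<inter> ?h -` Q))"
        "\<delta>' (snd ` (A \<inter> ?h -` P)) (snd ` (B \<inter> ?h -` Q))"
      by blast
    \<comment> \<open>The map \<open>map_prod u v\<close> sends each pulled-back piece onto the piece it comes from,
        so \<open>u\<close> and \<open>v\<close> do the same with its projections.\<close>
    have im: "u ` fst ` (S \<inter> ?h -` R) = fst ` R" "v ` snd ` (S \<inter> ?h -` R) = snd ` R"
      if "R \<subseteq> ?h ` S" for R S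
    proof -
      have "k ` (S \<inter> k -` R) = R" if "R \<subseteq> k ` S" for k :: "'a \<times> 'c \<Rightarrow> 'b \<times> 'd"
        using that by blast
      from this[OF that] have "R = ?h ` (S \<inter> ?h -` R)" by simp
      then have "fst ` R = fst ` ?h ` (S \<inter> ?h -` R)" "snd ` R = snd ` ?h ` (S \<inter> ?h -` R)"
        by simp_all
      then show "u ` fst ` (S \<inter> ?h -` R) = fst ` R" "v ` snd ` (S \<inter> ?h -` R) = snd ` R"
        by (simp_all add: image_image)
    qed
    have "P \<subseteq> ?h ` A" "Q \<subseteq> ?h ` B" using PQ unfolding un[symmetric] by blast+
    note im' = im[OF this(1)] im[OF this(2)]
    have "fst ` (A \<inter> ?h -` P) \<subseteq> X" "fst ` (B \<inter> ?h -` Q) \<subseteq> X"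
      "snd ` (A \<inter> ?h -` P) \<subseteq> X'" "snd ` (B \<inter> ?h -` Q) \<subseteq> X'"
      using sub by auto
    then have "\<epsilon> (fst ` P) (fst ` Q)" "\<epsilon>' (snd ` P) (snd ` Q)"
      using u v near' unfolding pc_map_def im'[symmetric] by blast+
    then show "\<exists>P\<in>\<A>. \<exists>Q\<in>\<B>. \<epsilon> (fst ` P) (fst ` Q) \<and> \<epsilon>' (snd ` P) (snd ` Q)"
      using PQ by blast
  qed
qed

section \<open>Gluing along a slice of the cylinder\<close>

text \<open>
  The product proximity of \<open>X \<times> J\<close> for a set \<open>J\<close> of reals, such as the
  time interval of a homotopy, with its metric proximity.
\<close>

abbreviation cylinder_proximity ::
  "'a set \<Rightarrow> ('a set \<Rightarrow> 'a set \<Rightarrow> bool) \<Rightarrow> real set \<Rightarrow>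
   ('a \<times> real) set \<Rightarrow> ('a \<times> real) set \<Rightarrow> bool" where
  "cylinder_proximity X \<delta> J \<equiv> prod_proximity X \<delta> J (metric_proximity J)"

text \<open>
  Near sets on opposite sides of the slice \<open>X \<times> {c}\<close> cannot be separated by a partition of the
  slice. The reason is that real sets separated by \<open>c\<close> are near only if both are near
  \<open>{c}\<close>, which takes care of the second coordinate; in \<open>X\<close> it remains to cut the first
  projection of one of the sets along \<open>W\<close>.
\<close>

lemma (in proximity_space) prod_proximity_near_slice:
  assumes near: "cylinder_proximity X \<delta> J A B"
    and A: "snd ` A \<subseteq> {..c}" and B: "snd ` B \<subseteq> {c..}" and c: "c \<in> J" and W: "W \<subseteq> X"
  shows "cylinder_proximity X \<delta> J A (W \<times> {c}) \<or> cylinder_proximity X \<delta> J ((X - W) \<times> {c}) B"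
proof (rule ccontr)
  let ?\<mu> = "metric_proximity J"
  assume "\<not> ?thesis"
  then have far: "\<not> cylinder_proximity X \<delta> J A (W \<times> {c})"
    "\<not> cylinder_proximity X \<delta> J ((X - W) \<times> {c}) B" by auto
  have sub: "A \<subseteq> X \<times> J" "B \<subseteq> X \<times> J" using prod_proximity_subset[OF near] by auto
  have slice: "W \<times> {c} \<subseteq> X \<times> J" "(X - W) \<times> {c} \<subseteq> X \<times> J" using W c by auto
  obtain \<A> \<C> where 1: "finite \<A>" "finite \<C>" "\<Union>\<A> = A" "\<Union>\<C> = W \<times> {c}"
    and far1: "\<not> (\<exists>P\<in>\<A>. \<exists>Q\<in>\<C>. \<delta> (fst ` P) (fst ` Q) \<and> ?\<mu> (snd ` P) (snd ` Q))"
    by (rule not_prod_proximityE[OF far(1) sub(1) slice(1)])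
  obtain \<D> \<B> where 2: "finite \<D>" "finite \<B>" "\<Union>\<D> = (X - W) \<times> {c}" "\<Union>\<B> = B"
    and far2: "\<not> (\<exists>P\<in>\<D>. \<exists>Q\<in>\<B>. \<delta> (fst ` P) (fst ` Q) \<and> ?\<mu> (snd ` P) (snd ` Q))"
    by (rule not_prod_proximityE[OF far(2) slice(2) sub(2)])
  obtain P Q where PQ: "P \<in> \<A>" "Q \<in> \<B>" "\<delta> (fst ` P) (fst ` Q)" "?\<mu> (snd ` P) (snd ` Q)"
    using prod_proximityD[OF near, of \<A> \<B>] 1 2 by blast
  have "P \<subseteq> A" "Q \<subseteq> B" using PQ 1 2 by auto
  then have PX: "fst ` P \<subseteq> X" and QX: "fst ` Q \<subseteq> X"
    and "snd ` P \<subseteq> {..c}" "snd ` Q \<subseteq> {c..}"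
    using sub A B by fastforce+
  then have \<mu>c: "?\<mu> (snd ` P) {c}" "?\<mu> {c} (snd ` Q)"
    using metric_proximity_separating_point[OF PQ(4)] c by auto
  have snd_eq: "snd ` R = {c}" if "R \<subseteq> S \<times> {c}" "fst ` R \<noteq> {}" for R and S :: "'a set"
    using that by force
  have "\<delta> (fst ` Q \<inter> W \<union> (fst ` Q - W)) (fst ` P)"
    using PQ(3) near_sym by (simp add: Int_Diff_Un)
  then have "\<delta> (fst ` Q \<inter> W) (fst ` P) \<or> \<delta> (fst ` Q - W) (fst ` P)"
    using near_Un[of "fst ` Q \<inter> W" "fst ` Q - W" "fst ` P"] PX QX by blast
  then show False
  proof
    assume "\<delta> (fst ` Q \<inter> W) (fst ` P)"
    then have "\<delta> (fst ` P) W"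
      using near_mono[OF near_sym] PX W by blast
    moreover have "W = \<Union>(image fst ` \<C>)"
      using 1(4) by (metis fst_image_times image_Union insert_not_empty)
    ultimately obtain R where R: "R \<in> \<C>" "\<delta> (fst ` P) (fst ` R)"
      using near_Union_right[of "image fst ` \<C>" "fst ` P"] 1(2) W by auto
    then have "snd ` R = {c}"
      using snd_eq[of R W] near_nonempty 1(4) by blast
    then show False using far1 PQ(1) R \<mu>c by metis
  next
    assume "\<delta> (fst ` Q - W) (fst ` P)"
    then have "(fst ` Q) \<inter> (X - W) \<noteq> {}"
      using near_nonempty QX by blast
    then have "\<delta> (fst ` Q) (X - W)"
      using near_Int QX by blast
    moreover have "X - W = \<Union>(image fst ` \<D>)"
      using 2(3) by (metis fst_image_times image_Union insert_not_empty)
    ultimately obtain R where R: "R \<in> \<D>" "\<delta> (fst ` Q) (fst ` R)"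
      using near_Union_right[of "image fst ` \<D>" "fst ` Q"] 2(1) by auto
    then have "snd ` R = {c}"
      using snd_eq[of R "X - W"] near_nonempty 2(3) by blast
    then show False using far2 R(1) PQ(2) near_sym[OF R(2)] \<mu>c by metis
  qed
qed

lemma near_images_across_slice:
  assumes "proximity_space X \<delta>" and "proximity_space Y \<delta>'"
    and G: "pc_map (X \<times> J) (cylinder_proximity X \<delta> J) Y \<delta>' G"
    and H: "pc_map (X \<times> J) (cylinder_proximity X \<delta> J) Y \<delta>' H"
    and agree: "\<And>x. x \<in> X \<Longrightarrow> G (x, c) = H (x, c)" and c: "c \<in> J"
    and near: "cylinder_proximity X \<delta> J A B"
    and A: "snd ` A \<subseteq> {..c}" and B: "snd ` B \<subseteq> {c..}"
  shows "\<delta>' (G ` A) (H ` B)"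
proof (rule ccontr)
  interpret X: proximity_space X \<delta> by fact
  interpret Y: proximity_space Y \<delta>' by fact
  assume far: "\<not> \<delta>' (G ` A) (H ` B)"
  have sub: "A \<subseteq> X \<times> J" "B \<subseteq> X \<times> J" using prod_proximity_subset[OF near] by auto
  have GA: "G ` A \<subseteq> Y" and HB: "H ` B \<subseteq> Y"
    using G H sub by (auto simp: pc_map_def Pi_iff)
  obtain C where C: "C \<subseteq> Y" "\<not> \<delta>' (G ` A) C" "\<not> \<delta>' (Y - C) (H ` B)"
    using Y.far_separate[OF GA HB far] by blast
  define W where "W = {x \<in> X. G (x, c) \<in> C}"
  have W: "W \<subseteq> X" by (auto simp: W_def)
  have slice: "W \<times> {c} \<subseteq> X \<times> J" "(X - W) \<times> {c} \<subseteq> X \<times> J" using W c by auto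
  from X.prod_proximity_near_slice[OF near A B c W] show False
  proof
    assume "cylinder_proximity X \<delta> J A (W \<times> {c})"
    then have "\<delta>' (G ` A) (G ` (W \<times> {c}))"
      using G sub slice by (simp add: pc_map_def)
    moreover have "G ` (W \<times> {c}) \<subseteq> C" by (auto simp: W_def)
    ultimately show False using Y.near_mono C GA by blast
  next
    assume "cylinder_proximity X \<delta> J ((X - W) \<times> {c}) B"
    then have "\<delta>' (H ` ((X - W) \<times> {c})) (H ` B)"
      using H sub slice by (simp add: pc_map_def)
    moreover have "H ` ((X - W) \<times> {c}) \<subseteq> Y - C"
      using H c agree by (auto simp: W_def pc_map_def Pi_iff)
    ultimately show False using Y.near_mono[of _ _ "Y - C" "H ` B"] C HB by blast
  qed
qed

lemma pc_map_glue:
  assumes X: "proximity_space X \<delta>" and Y: "proximity_space Y \<delta>'"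
    and G: "pc_map (X \<times> J) (cylinder_proximity X \<delta> J) Y \<delta>' G"
    and H: "pc_map (X \<times> J) (cylinder_proximity X \<delta> J) Y \<delta>' H"
    and agree: "\<And>x. x \<in> X \<Longrightarrow> G (x, c) = H (x, c)" and c: "c \<in> J"
  shows "pc_map (X \<times> J) (cylinder_proximity X \<delta> J) Y \<delta>' (\<lambda>z. if snd z \<le> c then G z else H z)"
    (is "pc_map _ _ _ _ ?K")
  unfolding pc_map_def
proof (intro conjI allI impI)
  interpret X: proximity_space X \<delta> by fact
  interpret Y: proximity_space Y \<delta>' by fact
  show K: "?K \<in> X \<times> J \<rightarrow> Y"
    using G H by (auto simp: pc_map_def Pi_iff)
  fix A B assume "A \<subseteq> X \<times> J \<and> B \<subseteq> X \<times> J \<and> cylinder_proximity X \<delta> J A B"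
  then have sub: "A \<subseteq> X \<times> J" "B \<subseteq> X \<times> J" and near: "cylinder_proximity X \<delta> J A B" by auto
  define lower upper where "lower S = S \<inter> snd -` {..c}" and "upper S = S \<inter> snd -` {c<..}"
    for S :: "('a \<times> real) set"
  have split: "lower S \<union> upper S = S" for S by (auto simp: lower_def upper_def)
  have side: "snd ` lower S \<subseteq> {..c}" "snd ` upper S \<subseteq> {c..}" for S
    by (auto simp: lower_def upper_def)
  have K_lower: "?K ` lower S = G ` lower S" and K_upper: "?K ` upper S = H ` upper S" for S
    by (auto simp: lower_def upper_def intro!: image_cong)
  have sub': "lower A \<subseteq> X \<times> J" "upper A \<subseteq> X \<times> J" "lower B \<subseteq> X \<times> J" "upper B \<subseteq> X \<times> J"
    using sub by (auto simp: lower_def upper_def)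
  have split_left: "cylinder_proximity X \<delta> J (lower S) T \<or> cylinder_proximity X \<delta> J (upper S) T"
    if "cylinder_proximity X \<delta> J S T" for S T
  proof (rule prod_proximity_Un_left)
    show "cylinder_proximity X \<delta> J (lower S \<union> upper S) T" using that split by simp
    show "\<delta> E F'" if "\<delta> E F" "F \<subseteq> F'" "F' \<subseteq> X" for E F F'
      using X.near_mono[OF that(1) order_refl that(2)] X.near_subset[OF that(1)] that by blast
    show "metric_proximity J E F'"
      if "metric_proximity J E F" "F \<subseteq> F'" "F' \<subseteq> J" for E F F'
      using metric_proximity_mono[OF that(1) order_refl that(2)] that
      by (simp add: metric_proximity_iff)
  qed
  have sym: "cylinder_proximity X \<delta> J T S" if "cylinder_proximity X \<delta> J S T" for S T
    using prod_proximity_sym[OF that X.near_sym metric_proximity_sym] .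
  note cross = near_images_across_slice[OF X Y G H agree c _ side]
  have "\<exists>S\<in>{lower A, upper A}. \<exists>T\<in>{lower B, upper B}. cylinder_proximity X \<delta> J S T"
    using split_left[OF near] split_left[OF sym, of "lower A" B] split_left[OF sym, of "upper A" B] sym
    by blast
  then obtain S T where S: "S \<in> {lower A, upper A}" and T: "T \<in> {lower B, upper B}"
    and ST: "cylinder_proximity X \<delta> J S T" by blast
  have "\<delta>' (?K ` S) (?K ` T)"
  proof -
    consider "S = lower A" "T = lower B" | "S = upper A" "T = upper B"
      | "S = lower A" "T = upper B" | "S = upper A" "T = lower B"
      using S T by blast
    then show ?thesis
    proof cases
      case 1
      then show ?thesis using G ST sub' by (simp only: K_lower pc_map_def)
    next
      case 2
      then show ?thesis using H ST sub' by (simp only: K_upper pc_map_def)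
    next
      case 3
      then show ?thesis using cross[of A B] ST by (simp only: K_lower K_upper)
    next
      case 4
      then show ?thesis using Y.near_sym cross[of B A] sym[OF ST] by (simp only: K_lower K_upper)
    qed
  qed
  moreover have "S \<subseteq> A" "T \<subseteq> B" using S T by (auto simp: lower_def upper_def)
  moreover have "?K ` A \<subseteq> Y" "?K ` B \<subseteq> Y" using K sub by blast+
  ultimately show "\<delta>' (?K ` A) (?K ` B)"
    using Y.near_mono[of "?K ` S" "?K ` T"] by (meson image_mono)
qed

section \<open>Proximal homotopy\<close>

lemma prox_homotopic_restrict:
  assumes "prox_homotopic X \<delta> Y \<delta>' f g" "V \<subseteq> X"
  shows "prox_homotopic V (sub_proximity \<delta> V) Y \<delta>' f g"
proof -
  obtain G where G: "pc_map (X \<times> {0..1}) (cylinder_proximity X \<delta> {0..1}) Y \<delta>' G"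
    and ends: "\<And>x. x \<in> X \<Longrightarrow> G (x, 0) = f x \<and> G (x, 1) = g x"
    using assms(1) by (auto simp: prox_homotopic_def)
  have "pc_map {0..1::real} (metric_proximity {0..1}) {0..1} (metric_proximity {0..1}) id"
    by (simp add: pc_map_def)
  from pc_map_comp[OF pc_map_map_prod[OF pc_map_inclusion[OF assms(2)] this] G]
  show ?thesis
    unfolding prox_homotopic_def using ends assms(2) by (intro exI conjI) auto
qed

lemma prox_homotopic_coarsen:
  assumes "prox_homotopic X \<delta> Y \<delta>2' f g" "finer_proximity \<delta>2' \<delta>2"
  shows "prox_homotopic X \<delta> Y \<delta>2 f g"
  using assms pc_map_coarsen unfolding prox_homotopic_def by metis

lemma pc_map_reparametrize:
  assumes G: "pc_map (X \<times> {0..1}) (cylinder_proximity X \<delta> {0..1}) Y \<delta>' G"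
    and v: "v \<in> {0..1} \<rightarrow> {0..1}" and L: "L > 0"
    and lip: "\<And>s t. s \<in> {0..1} \<Longrightarrow> t \<in> {0..1} \<Longrightarrow> dist (v s) (v t) \<le> L * dist s t"
  shows "pc_map (X \<times> {0..1}) (cylinder_proximity X \<delta> {0..1}) Y \<delta>' (\<lambda>(x, t). G (x, v t))"
proof -
  have "pc_map X \<delta> X \<delta> id" by (simp add: pc_map_def)
  from pc_map_comp[OF pc_map_map_prod[OF this pc_map_lipschitz[OF v L lip]] G]
  have "pc_map (X \<times> {0..1}) (cylinder_proximity X \<delta> {0..1}) Y \<delta>' (G \<circ> map_prod id v)" .
  moreover have "G \<circ> map_prod id v = (\<lambda>(x, t). G (x, v t))" by auto
  ultimately show ?thesis by simp
qed

lemma prox_homotopic_sym: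
  assumes "prox_homotopic X \<delta> Y \<delta>' f g"
  shows "prox_homotopic X \<delta> Y \<delta>' g f"
proof -
  obtain G where G: "pc_map (X \<times> {0..1}) (cylinder_proximity X \<delta> {0..1}) Y \<delta>' G"
    and ends: "\<And>x. x \<in> X \<Longrightarrow> G (x, 0) = f x \<and> G (x, 1) = g x"
    using assms by (auto simp: prox_homotopic_def)
  have "pc_map (X \<times> {0..1}) (cylinder_proximity X \<delta> {0..1}) Y \<delta>' (\<lambda>(x, t). G (x, 1 - t))"
    by (rule pc_map_reparametrize[OF G, where L = 1]) (auto simp: dist_real_def)
  then show ?thesis
    unfolding prox_homotopic_def using ends by (intro exI conjI) auto
qed

lemma prox_homotopic_trans:
  assumes X: "proximity_space X \<delta>" and Y: "proximity_space Y \<delta>'"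
    and fg: "prox_homotopic X \<delta> Y \<delta>' f g" and gh: "prox_homotopic X \<delta> Y \<delta>' g h"
  shows "prox_homotopic X \<delta> Y \<delta>' f h"
proof -
  obtain G where G: "pc_map (X \<times> {0..1}) (cylinder_proximity X \<delta> {0..1}) Y \<delta>' G"
    and G_ends: "\<And>x. x \<in> X \<Longrightarrow> G (x, 0) = f x \<and> G (x, 1) = g x"
    using fg by (auto simp: prox_homotopic_def)
  obtain H where H: "pc_map (X \<times> {0..1}) (cylinder_proximity X \<delta> {0..1}) Y \<delta>' H"
    and H_ends: "\<And>x. x \<in> X \<Longrightarrow> H (x, 0) = g x \<and> H (x, 1) = h x"
    using gh by (auto simp: prox_homotopic_def)
  \<comment> \<open>Truncating the time changes makes both halves of the concatenation pc-maps on all of the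
      cylinder, so that no proximity on half of it is needed.\<close>
  let ?G = "\<lambda>(x, t). G (x, min 1 (2 * t))" and ?H = "\<lambda>(x, t). H (x, max 0 (2 * t - 1))"
  have lip: "\<bar>min 1 (2 * s) - min 1 (2 * t)\<bar> \<le> 2 * \<bar>s - t\<bar>"
    "\<bar>max 0 (2 * s - 1) - max 0 (2 * t - 1)\<bar> \<le> 2 * \<bar>s - t\<bar>" for s t :: real
    by (simp_all add: min_def max_def abs_if)
  have G': "pc_map (X \<times> {0..1}) (cylinder_proximity X \<delta> {0..1}) Y \<delta>' ?G"
    by (rule pc_map_reparametrize[OF G, where L = 2]) (auto simp: dist_real_def lip)
  have H': "pc_map (X \<times> {0..1}) (cylinder_proximity X \<delta> {0..1}) Y \<delta>' ?H"
    by (rule pc_map_reparametrize[OF H, where L = 2]) (auto simp: dist_real_def lip)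
  have "pc_map (X \<times> {0..1}) (cylinder_proximity X \<delta> {0..1}) Y \<delta>'
          (\<lambda>z. if snd z \<le> 1 / 2 then ?G z else ?H z)"
    by (rule pc_map_glue[OF X Y G' H']) (use G_ends H_ends in auto)
  then show ?thesis
    unfolding prox_homotopic_def using G_ends H_ends by (intro exI conjI) auto
qed

section \<open>Comparison of the distances\<close>

lemma prox_homotopic_distance_le:
  assumes "\<And>m. prox_homotopic_cover X \<delta> Y \<delta>' f g m \<Longrightarrow> prox_homotopic_cover Z \<epsilon> W \<epsilon>' h k m"
  shows "prox_homotopic_distance Z \<epsilon> W \<epsilon>' h k \<le> prox_homotopic_distance X \<delta> Y \<delta>' f g"
proof (cases "\<exists>m>0. prox_homotopic_cover X \<delta> Y \<delta>' f g m")
  case True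
  define n where "n = (LEAST m. m > 0 \<and> prox_homotopic_cover X \<delta> Y \<delta>' f g m)"
  have "n > 0 \<and> prox_homotopic_cover X \<delta> Y \<delta>' f g n"
    unfolding n_def using True by (rule LeastI_ex)
  then have n: "n > 0 \<and> prox_homotopic_cover Z \<epsilon> W \<epsilon>' h k n"
    using assms by blast
  then have "(LEAST m. m > 0 \<and> prox_homotopic_cover Z \<epsilon> W \<epsilon>' h k m) \<le> n"
    by (rule Least_le)
  then show ?thesis
    using True n unfolding prox_homotopic_distance_def n_def by auto
next
  case False
  then have "prox_homotopic_distance X \<delta> Y \<delta>' f g = \<infinity>"
    unfolding prox_homotopic_distance_def by (rule if_not_P)
  then show ?thesis by simp
qed

theorem theorem4p5:
  fixes X :: "'a set" and Y :: "'b set"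
    and \<delta>1 :: "'a set \<Rightarrow> 'a set \<Rightarrow> bool"
    and \<delta>2 \<delta>2' :: "'b set \<Rightarrow> 'b set \<Rightarrow> bool"
    and f1 f2 g1 g2 :: "'a \<Rightarrow> 'b"
  assumes "proximity_space X \<delta>1"
    and "proximity_space Y \<delta>2"
    and "proximity_space Y \<delta>2'"
    and "pc_map X \<delta>1 Y \<delta>2 f1" and "pc_map X \<delta>1 Y \<delta>2 f2"
    and "pc_map X \<delta>1 Y \<delta>2' g1" and "pc_map X \<delta>1 Y \<delta>2' g2"
    and "prox_homotopic X \<delta>1 Y \<delta>2 f1 f2"
    and "prox_homotopic X \<delta>1 Y \<delta>2' g1 g2"
    and "finer_proximity \<delta>2' \<delta>2"
  shows "prox_homotopic_distance X \<delta>1 Y \<delta>2 f1 g1 \<le> prox_homotopic_distance X \<delta>1 Y \<delta>2' f2 g2"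
proof (rule prox_homotopic_distance_le)
  fix m assume "prox_homotopic_cover X \<delta>1 Y \<delta>2' f2 g2 m"
  then obtain V where V: "(\<Union>j\<in>{1..m}. V j) = X"
    and hom: "\<And>j. j \<in> {1..m} \<Longrightarrow> prox_homotopic (V j) (sub_proximity \<delta>1 (V j)) Y \<delta>2' f2 g2"
    by (auto simp: prox_homotopic_cover_def)
  have "prox_homotopic (V j) (sub_proximity \<delta>1 (V j)) Y \<delta>2 f1 g1" if j: "j \<in> {1..m}" for j
  proof -
    have sub: "V j \<subseteq> X" using V j by blast
    note trans = prox_homotopic_trans[OF
        proximity_space.proximity_space_sub_proximity[OF assms(1) sub] assms(2)]
    have "prox_homotopic (V j) (sub_proximity \<delta>1 (V j)) Y \<delta>2 f1 f2"
      using prox_homotopic_restrict[OF assms(8) sub] .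
    moreover have "prox_homotopic (V j) (sub_proximity \<delta>1 (V j)) Y \<delta>2 f2 g2"
      using prox_homotopic_coarsen[OF hom[OF j] assms(10)] .
    moreover have "prox_homotopic (V j) (sub_proximity \<delta>1 (V j)) Y \<delta>2 g2 g1"
      using prox_homotopic_sym[OF prox_homotopic_restrict[OF
          prox_homotopic_coarsen[OF assms(9,10)] sub]] .
    ultimately show ?thesis using trans by blast
  qed
  then show "prox_homotopic_cover X \<delta>1 Y \<delta>2 f1 g1 m"
    unfolding prox_homotopic_cover_def using V by blast
qed

end
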